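(* Let $d\ge2$ be an integer, let $a \in \mathbb{R}^d$ satisfy $\bar a_k>0$ for $k=2,\dots,d$, and suppose that $\bar a_1 = -M$ for some $M \in \mathbb{N}$. Set $$C = \mathbb{E}_{a+Me_1}\left[\frac{1}{Y_1^M}\right],$$ which is explicitly given by $C=\sum_{m \in \mathbb{N}_0^d(M)}\binom{M}{m_1,\dots, m_d}\prod_{k=2}^d \frac{ \bar a_k}{\bar a_k + \bar m_k}$. Then: 1. the moment generating function of the log gaps $Z_2,\dots,Z_d$ is given by $$\mathbb{E}_a\left[e^{t_2Z_2 + \dots + t_dZ_d}\right] = C^{-1}\sum_{m \in \mathbb{N}_0^d(M)} \binom{M}{m_1,\dots, m_d}\prod_{k=2}^d \frac{ \bar a_k}{\bar a_k - t_k + \bar m_k}$$ for all real $t_2,\dots,t_d$ with $t_k < \bar a_k$ for $k=2,\dots,d$; 2. for any $n = (n_2,\dots,n_d) \in \mathbb{N}_0^{d-1}$, $$\mathbb{E}_a\left[\prod_{k=2}^d Z_k^{n_k}\right] = C^{-1}\sum_{m \in \mathbb{N}_0^d(M)} \binom{M}{m_1,\dots, m_d}\prod_{k=2}^d \frac{ \bar a_k\, n_k!}{(\bar a_k + \bar m_k)^{n_k+1}}.$$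
   Context: For a vector $v \in \mathbb{R}^d$, write $\bar v_k := v_k + v_{k+1} + \dots + v_d$ for its tail sums, $k=1,\dots,d$; $e_1,\dots,e_d$ is the standard basis of $\mathbb{R}^d$. $\mathbb{N} = \{1,2,\dots\}$, $\mathbb{N}_0 = \mathbb{N}\cup\{0\}$, and for $M\in\mathbb{N}$, $\mathbb{N}_0^d(M) = \{m \in \mathbb{N}_0^d : \bar m_1 = M\}$. For $m\in\mathbb{N}_0^d(M)$, $\binom{M}{m_1,\dots,m_d} = \frac{M!}{m_1!\cdots m_d!}$. The ordered simplex is $\nabla^{d-1} = \{y \in \mathbb{R}^d: y_1 \geq y_2\geq \dots \geq y_d \geq 0,\ y_1+\dots+y_d = 1\}$. Integrals $dy$ over $\nabla^{d-1}$ are with respect to the pushforward of Lebesgue measure on $\mathbb{R}^{d-1}$ under $(y_1,\dots,y_{d-1}) \mapsto (y_1,\dots,y_{d-1},1-y_1-\dots-y_{d-1})$. For $a \in \mathbb{R}^d$ with $\bar a_k>0$ for $k=2,\dots,d$, the constant $Q_a = \int_{\nabla^{d-1}}\prod_{k=1}^d y_k^{a_k-1}\,dy$ is finite (known fact), and the Generalized Rank Dirichlet distribution GRD$(a)$ is the probability measure $\mathbb{P}_a(A) = Q_a^{-1}\int_{\nabla^{d-1}} \prod_{k=1}^d y_k^{a_k-1} 1_A(y)\,dy$ on Borel subsets $A$ of $\nabla^{d-1}$. $\mathbb{E}_a$ denotes expectation under $\mathbb{P}_a$, and $Y=(Y_1,\dots,Y_d)$ is a random vector with law $\mathbb{P}_a$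 under $\mathbb{P}_a$ (e.g. the identity map on $\nabla^{d-1}$). The log gaps are $Z_k = \log Y_{k-1} - \log Y_k$ for $k=2,\dots,d$ (almost surely well defined since $Y_d>0$ almost surely). *)

theory Defs
  imports "HOL-Analysis.Analysis"
begin

text \<open>
  A vector in dimension \<open>d\<close> is a function on \<open>nat\<close> of which only the components with index in
  \<open>{1..d}\<close> matter. Where a set or a space of vectors is formed, it consists of extensional
  functions on \<open>{1..d}\<close> (undefined outside), so that each vector is counted exactly once.
\<close>

definition tail_sum :: "nat \<Rightarrow> (nat \<Rightarrow> 'a::comm_monoid_add) \<Rightarrow> nat \<Rightarrow> 'a" where
  "tail_sum d v k = (\<Sum>i=k..d. v i)"

definition multi_indices :: "nat \<Rightarrow> nat \<Rightarrow> (nat \<Rightarrow> nat) set" where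
  "multi_indices d M = {m \<in> {1..d} \<rightarrow>\<^sub>E UNIV. tail_sum d m 1 = M}"

definition multinomial :: "nat \<Rightarrow> nat \<Rightarrow> (nat \<Rightarrow> nat) \<Rightarrow> real" where
  "multinomial d M m = fact M / (\<Prod>i=1..d. fact (m i))"

definition ordered_simplex :: "nat \<Rightarrow> (nat \<Rightarrow> real) set" where
  "ordered_simplex d = {y \<in> {1..d} \<rightarrow>\<^sub>E UNIV.
     (\<forall>k\<in>{2..d}. y k \<le> y (k - 1)) \<and> 0 \<le> y d \<and> (\<Sum>k=1..d. y k) = 1}"

definition simplex_chart :: "nat \<Rightarrow> (nat \<Rightarrow> real) \<Rightarrow> nat \<Rightarrow> real" where
  "simplex_chart d x = (\<lambda>i\<in>{1..d}. if i = d then 1 - (\<Sum>j=1..<d. x j) else x i)"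

text \<open>The reference measure \<open>dy\<close> on the Borel sets of the ordered simplex.\<close>

definition simplex_measure :: "nat \<Rightarrow> (nat \<Rightarrow> real) measure" where
  "simplex_measure d =
     restrict_space
       (distr (\<Pi>\<^sub>M i\<in>{1..<d}. lborel) (\<Pi>\<^sub>M i\<in>{1..d}. borel) (simplex_chart d))
       (ordered_simplex d)"

text \<open>
  Since \<open>0 powr x = 0\<close>, the weight is set to \<open>0\<close> on the null set where some component vanishes.
\<close>

definition grd_weight :: "nat \<Rightarrow> (nat \<Rightarrow> real) \<Rightarrow> (nat \<Rightarrow> real) \<Rightarrow> real" where
  "grd_weight d a y = (\<Prod>k=1..d. y k powr (a k - 1))"

definition grd_const :: "nat \<Rightarrow> (nat \<Rightarrow> real) \<Rightarrow> ennreal" where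
  "grd_const d a = (\<integral>\<^sup>+ y. ennreal (grd_weight d a y) \<partial>simplex_measure d)"

definition GRD :: "nat \<Rightarrow> (nat \<Rightarrow> real) \<Rightarrow> (nat \<Rightarrow> real) measure" where
  "GRD d a = density (simplex_measure d) (\<lambda>y. ennreal (grd_weight d a y) / grd_const d a)"

definition log_gap :: "nat \<Rightarrow> (nat \<Rightarrow> real) \<Rightarrow> real" where
  "log_gap k y = ln (y (k - 1)) - ln (y k)"

end

theory Submission
  imports Defs "HOL-Probability.Distributions"
begin

text \<open>
  In the log gaps \<open>z\<close>, the reference measure becomes \<open>y\<^sub>1 \<cdots> y\<^sub>d dz\<close> on the positive orthant, so that the
  unnormalised density is \<open>\<Prod>\<^sub>k y\<^sub>k powr a\<^sub>k\<close>, that is \<open>y\<^sub>1 powr (-M)\<close> times a product of exponentials of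
  rates \<open>tail_sum d a k\<close>. Since \<open>1 / y\<^sub>1\<close> is the sum of the ratios \<open>y\<^sub>i / y\<^sub>1\<close>, each an exponential of a
  linear form in \<open>z\<close>, the multinomial theorem turns the density into a sum over \<open>m\<close> of products of
  exponentials of rates \<open>tail_sum d a k + tail_sum d m k\<close>, and everything factorises. The change of
  variables is carried out one coordinate at a time: given \<open>y\<^sub>1, \<dots>, y\<^sub>k\<^sub>-\<^sub>1\<close> and the later gaps,
  \<open>y\<^sub>k = s / (1 + c exp (- z\<^sub>k\<^sub>+\<^sub>1))\<close>, where \<open>s\<close> is the remaining mass and \<open>c\<close> depends only on the later gaps.
\<close>

subsection \<open>One-dimensional substitution and the multinomial theorem\<close>

lemma indicator_UN_eq_SUP:
  "indicator (\<Union>i\<in>I. A i) x = (SUP i\<in>I. indicator (A i) x :: ennreal)"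
proof (cases "x \<in> (\<Union>i\<in>I. A i)")
  case True
  then obtain i where i: "i \<in> I" "x \<in> A i" by auto
  have "(SUP i\<in>I. indicator (A i) x :: ennreal) = 1"
    using i by (intro antisym SUP_least SUP_upper2[of i]) (auto simp: indicator_def)
  then show ?thesis using True by simp
next
  case False
  then have "(SUP i\<in>I. indicator (A i) x :: ennreal) = (SUP i\<in>I. 0)"
    by (intro SUP_cong) auto
  then show ?thesis using False by (cases "I = {}") (auto simp: bot_ennreal)
qed

text \<open>Exhaust the line by the intervals \<open>{- r n..r n}\<close>: the compact substitution
  rule applies on each, their images \<open>{g (- r n)..g (r n)}\<close> increase to
  \<open>range g\<close> by monotonicity and the intermediate value theorem, and monotone
  convergence passes to the limit on both sides.\<close>

lemma nn_integral_substitution_UNIV: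
  fixes f :: "real \<Rightarrow> ennreal" and g g' :: "real \<Rightarrow> real"
  assumes f [measurable]: "f \<in> borel_measurable borel"
    and g: "\<And>x. (g has_real_derivative g' x) (at x)"
    and contg': "continuous_on UNIV g'"
    and nonneg: "\<And>x. 0 \<le> g' x"
  shows "(\<integral>\<^sup>+x. f x * indicator (range g) x \<partial>lborel) = (\<integral>\<^sup>+x. f (g x) * g' x \<partial>lborel)"
proof -
  \<comment> \<open>\<open>Suc n\<close> instead of \<open>n\<close> makes every interval
    nondegenerate, as the compact rule requires.\<close>
  define r where "r n = real (Suc n)" for n
  have r: "\<exists>n. \<bar>x\<bar> \<le> r n" for x
  proof -
    obtain n :: nat where "\<bar>x\<bar> \<le> real n" using real_arch_simple by blast
    then have "\<bar>x\<bar> \<le> r n" by (simp add: r_def)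
    then show ?thesis ..
  qed
  have mono: "g x \<le> g y" if "x \<le> y" for x y
    using DERIV_nonneg_imp_nondecreasing[OF that] g nonneg by blast
  have contg: "continuous_on UNIV g"
    using g by (auto intro!: DERIV_isCont continuous_at_imp_continuous_on)
  have [measurable]: "g \<in> borel_measurable borel" "g' \<in> borel_measurable borel"
    using contg contg' by (auto intro: borel_measurable_continuous_onI)
  have range: "range g = (\<Union>n::nat. {g (- r n)..g (r n)})"
  proof (intro equalityI subsetI)
    fix y assume "y \<in> range g"
    then obtain x where y: "y = g x" by auto
    obtain n :: nat where "\<bar>x\<bar> \<le> r n" using r by blast
    then have "y \<in> {g (- r n)..g (r n)}" unfolding y by (auto intro!: mono)
    then show "y \<in> (\<Union>n::nat. {g (- r n)..g (r n)})" by blast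
  next
    fix y assume "y \<in> (\<Union>n::nat. {g (- r n)..g (r n)})"
    then obtain n :: nat where "g (- r n) \<le> y" "y \<le> g (r n)" by auto
    then have "\<exists>x. - r n \<le> x \<and> x \<le> r n \<and> g x = y"
      using contg by (intro IVT') (auto simp: r_def intro: continuous_on_subset)
    then show "y \<in> range g" by auto
  qed
  have inc: "r m \<le> r n" "g (- r n) \<le> g (- r m)" "g (r m) \<le> g (r n)" if "m \<le> n" for m n
    using that by (auto simp: r_def intro!: mono)
  have UN: "(\<Union>n::nat. {- r n..r n}) = UNIV"
  proof -
    have "\<exists>n::nat. - r n \<le> x \<and> x \<le> r n" for x
      using r[of x] by (simp add: abs_le_iff minus_le_iff conj_commute)
    then show ?thesis by auto
  qed
  have "(\<integral>\<^sup>+x. f x * indicator (range g) x \<partial>lborel)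
      = (\<integral>\<^sup>+x. (SUP n::nat. f x * indicator {g (- r n)..g (r n)} x) \<partial>lborel)"
    unfolding range by (intro nn_integral_cong) (simp add: SUP_mult_left_ennreal indicator_UN_eq_SUP)
  also have "\<dots> = (SUP n::nat. \<integral>\<^sup>+x. f x * indicator {g (- r n)..g (r n)} x \<partial>lborel)"
    by (intro nn_integral_monotone_convergence_SUP)
      (auto simp: incseq_def le_fun_def split: split_indicator dest: inc intro: order_trans)
  also have "\<dots> = (SUP n::nat. \<integral>\<^sup>+x. f (g x) * g' x * indicator {- r n..r n} x \<partial>lborel)"
    using g nonneg contg'
    by (intro SUP_cong refl nn_integral_substitution_aux) (auto simp: r_def intro: continuous_on_subset)
  also have "\<dots> = (\<integral>\<^sup>+x. (SUP n::nat. f (g x) * g' x * indicator {- r n..r n} x) \<partial>lborel)"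
    by (intro nn_integral_monotone_convergence_SUP[symmetric])
      (auto simp: incseq_def le_fun_def split: split_indicator dest: inc)
  also have "\<dots> = (\<integral>\<^sup>+x. f (g x) * g' x * indicator (\<Union>n::nat. {- r n..r n}) x \<partial>lborel)"
    by (intro nn_integral_cong) (simp add: SUP_mult_left_ennreal indicator_UN_eq_SUP)
  finally show ?thesis by (simp add: UN)
qed

text \<open>For remaining mass \<open>s\<close> and fixed \<open>c\<close>, the logistic map sends a
  log gap \<open>u\<close> to a component of \<open>y\<close>; it increases from \<open>0\<close> to
  \<open>s\<close>, and the last factor is its derivative.\<close>

lemma nn_integral_logistic_substitution:
  fixes f :: "real \<Rightarrow> ennreal" and s c :: real
  assumes f [measurable]: "f \<in> borel_measurable borel" and s: "0 < s" and c: "0 < c"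
  shows "(\<integral>\<^sup>+x. f x * indicator {0<..<s} x \<partial>lborel) =
    (\<integral>\<^sup>+u. f (s / (1 + exp (- u) * c)) * ennreal (s * (exp (- u) * c) / (1 + exp (- u) * c)\<^sup>2) \<partial>lborel)"
proof -
  have pos: "1 + exp (- u) * c > 0" for u using c by (simp add: add_pos_pos)
  have range: "range (\<lambda>u. s / (1 + exp (- u) * c)) = {0<..<s}"
  proof (intro equalityI subsetI)
    fix x assume "x \<in> range (\<lambda>u. s / (1 + exp (- u) * c))"
    then show "x \<in> {0<..<s}" using s c pos by (auto simp: field_simps)
  next
    fix x assume x: "x \<in> {0<..<s}"
    \<comment> \<open>The preimage comes from solving \<open>x = s / (1 + exp (- u) * c)\<close> for
      \<open>u\<close>; the argument of \<open>ln\<close> is positive because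
      \<open>x < s\<close>.\<close>
    then have "exp (- (- ln ((s / x - 1) / c))) * c = s / x - 1"
      using c by (simp add: field_simps)
    then have "x = s / (1 + exp (- (- ln ((s / x - 1) / c))) * c)" using x by simp
    then show "x \<in> range (\<lambda>u. s / (1 + exp (- u) * c))" by blast
  qed
  show ?thesis
    unfolding range[symmetric]
  proof (rule nn_integral_substitution_UNIV)
    show "((\<lambda>u. s / (1 + exp (- u) * c)) has_real_derivative
            s * (exp (- u) * c) / (1 + exp (- u) * c)\<^sup>2) (at u)" for u
      using pos[of u] by (auto intro!: derivative_eq_intros simp: power2_eq_square)
    show "continuous_on UNIV (\<lambda>u. s * (exp (- u) * c) / (1 + exp (- u) * c)\<^sup>2)"
      using pos by (auto intro!: continuous_intros simp: less_imp_neq[symmetric])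
    show "0 \<le> s * (exp (- u) * c) / (1 + exp (- u) * c)\<^sup>2" for u
      using s c by simp
  qed simp
qed

section \<open>The multinomial theorem over extensional multi-indices\<close>

lemma finite_PiE_sum_eq:
  assumes "finite I"
  shows "finite {m \<in> I \<rightarrow>\<^sub>E UNIV. sum m I = (M::nat)}"
  by (rule finite_subset[OF _ finite_PiE[of I "\<lambda>_. {..M}"]])
     (use assms in \<open>auto simp: PiE_def Pi_def intro: member_le_sum\<close>)

text \<open>Induction on \<open>I\<close>: the binomial theorem separates \<open>x i\<close> from
  \<open>sum x I\<close>, whose power \<open>M - k\<close> is expanded by the induction hypothesis,
  hence \<open>M\<close> arbitrary.\<close>

lemma multinomial_theorem:
  fixes x :: "'a \<Rightarrow> real"
  assumes "finite I"
  shows "(\<Sum>i\<in>I. x i) ^ M =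
    (\<Sum>m\<in>{m \<in> I \<rightarrow>\<^sub>E UNIV. sum m I = M}. fact M / (\<Prod>i\<in>I. fact (m i)) * (\<Prod>i\<in>I. x i ^ m i))"
  using assms
proof (induction I arbitrary: M rule: finite_induct)
  case empty
  then show ?case by (cases "M = 0") (auto simp: PiE_empty_domain)
next
  case (insert i I)
  let ?S = "\<lambda>I M. {m \<in> I \<rightarrow>\<^sub>E UNIV. sum m I = (M::nat)}"
  let ?T = "\<lambda>I M m. fact M / (\<Prod>i\<in>I. fact (m i)) * (\<Prod>i\<in>I. x i ^ m i)"
  have upd: "(\<Prod>j\<in>I. fact ((m(i := k)) j)) = (\<Prod>j\<in>I. fact (m j) :: real)"
      "(\<Prod>j\<in>I. x j ^ (m(i := k)) j) = (\<Prod>j\<in>I. x j ^ m j)" for m k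
    using insert.hyps by (auto intro!: prod.cong)
  have sum_upd: "sum (m(i := k)) I = sum m I" for m :: "'a \<Rightarrow> nat" and k
    using insert.hyps by (intro sum.cong) auto
  have fin: "finite (?S I M)" for M
    using insert.hyps(1) by (rule finite_PiE_sum_eq)
  \<comment> \<open>A multi-index on \<open>insert i I\<close> amounts to \<open>k = m i\<close> and
    its restriction to \<open>I\<close>; the entry \<open>undefined\<close> at \<open>i\<close>
    makes the restriction extensional on \<open>I\<close>.\<close>
  have "(\<Sum>m\<in>?S (insert i I) M. ?T (insert i I) M m)
      = (\<Sum>(k, m)\<in>(SIGMA k:{..M}. ?S I (M - k)). ?T (insert i I) M (m(i := k)))"
  proof (rule sum.reindex_bij_witness[of _ "\<lambda>(k, m). m(i := k)" "\<lambda>m. (m i, m(i := undefined))"])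
    fix m assume m: "m \<in> ?S (insert i I) M"
    then have "m i + sum m I = M" using insert.hyps by simp
    then show "(m i, m(i := undefined)) \<in> (SIGMA k:{..M}. ?S I (M - k))"
      using m insert.hyps by (auto simp: sum_upd[simplified fun_upd_def] PiE_def extensional_def fun_upd_def)
    show "(case (m i, m(i := undefined)) of (k, m) \<Rightarrow> ?T (insert i I) M (m(i := k))) = ?T (insert i I) M m"
      by (simp del: fun_upd_apply)
  next
    fix km assume "km \<in> (SIGMA k:{..M}. ?S I (M - k))"
    then show "(case km of (k, m) \<Rightarrow> m(i := k)) \<in> ?S (insert i I) M"
      using insert.hyps by (auto simp: sum_upd[simplified fun_upd_def] PiE_def extensional_def fun_upd_def)
  qed (use insert.hyps in \<open>auto simp: PiE_def extensional_def fun_eq_iff\<close>)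
  also have "\<dots> = (\<Sum>k\<le>M. \<Sum>m\<in>?S I (M - k). ?T (insert i I) M (m(i := k)))"
    using fin by (subst sum.Sigma) auto
  \<comment> \<open>With entry \<open>k\<close> at \<open>i\<close>, the multinomial coefficient of
    \<open>M\<close> is \<open>M choose k\<close> times that of \<open>M - k\<close> on
    \<open>I\<close>.\<close>
  also have "\<dots> = (\<Sum>k\<le>M. \<Sum>m\<in>?S I (M - k). (of_nat (M choose k) * x i ^ k) * ?T I (M - k) m)"
  proof (intro sum.cong refl)
    fix k m assume "k \<in> {..M}"
    then have "fact M / fact k = real (M choose k) * fact (M - k)"
      by (simp add: binomial_fact)
    then show "?T (insert i I) M (m(i := k)) = (of_nat (M choose k) * x i ^ k) * ?T I (M - k) m"
      using insert.hyps
      by (simp add: upd fun_upd_same field_simps del: fun_upd_apply)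
  qed
  also have "\<dots> = (x i + sum x I) ^ M"
    unfolding binomial_ring insert.IH by (simp only: sum_distrib_left)
  finally show ?case using insert.hyps by simp
qed

subsection \<open>Log gaps as coordinates\<close>

text \<open>The mass \<open>y k + ... + y d\<close> left to distribute when \<open>v j\<close> is
  the component \<open>y j\<close> for \<open>j < k\<close>.\<close>

definition remainder :: "(nat \<Rightarrow> real) \<Rightarrow> nat \<Rightarrow> real" where
  "remainder v k = 1 - (\<Sum>j=1..<k. v j)"

text \<open>The ratio \<open>y i / y k\<close> when \<open>v j\<close> is the log gap between
  \<open>y j\<close> and \<open>y (j + 1)\<close> for \<open>j \<ge> k\<close>.\<close>

definition gap_factor :: "(nat \<Rightarrow> real) \<Rightarrow> nat \<Rightarrow> nat \<Rightarrow> real" where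
  "gap_factor v k i = exp (- (\<Sum>j=k..<i. v j))"

text \<open>The ratio of the remaining mass to \<open>y k\<close>; at \<open>k = 1\<close> it is
  \<open>1 / y 1\<close>.\<close>

definition gap_total :: "nat \<Rightarrow> (nat \<Rightarrow> real) \<Rightarrow> nat \<Rightarrow> real" where
  "gap_total d v k = (\<Sum>i=k..d. gap_factor v k i)"

text \<open>
  In the mixed coordinates at stage \<open>k\<close>, \<open>v j\<close> is the component \<open>y j\<close> for \<open>j < k\<close> and the
  log gap \<open>ln (y j) - ln (y (j + 1))\<close> (so \<open>Z\<close> with index \<open>j + 1\<close>) for \<open>j \<ge> k\<close>. Stage \<open>d\<close> is the
  chart of the simplex and at stage \<open>1\<close> all coordinates are log gaps; passing from stage \<open>k + 1\<close>
  to stage \<open>k\<close> replaces only the coordinate \<open>k\<close>.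
\<close>

definition mixed_chart :: "nat \<Rightarrow> nat \<Rightarrow> (nat \<Rightarrow> real) \<Rightarrow> nat \<Rightarrow> real" where
  "mixed_chart d k v = (\<lambda>i\<in>{1..d}. if i < k then v i
     else remainder v k / gap_total d v k * gap_factor v k i)"

text \<open>
  The Jacobian telescopes: step \<open>j\<close> contributes \<open>y j * (s - y j) / s\<close>, where \<open>s = remainder v j\<close>
  and \<open>s - y j\<close> is the next remainder.
\<close>

definition mixed_jacobian :: "nat \<Rightarrow> nat \<Rightarrow> (nat \<Rightarrow> real) \<Rightarrow> real" where
  "mixed_jacobian d k v = (\<Prod>i=k..d. mixed_chart d k v i) / remainder v k"

text \<open>The condition expresses positivity of all components, those from \<open>k\<close> on
  being positive multiples of the remainder; at \<open>k = 1\<close> it always holds. The ordering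
  of the components is left to \<open>F\<close>.\<close>

definition mixed_integrand ::
    "nat \<Rightarrow> ((nat \<Rightarrow> real) \<Rightarrow> ennreal) \<Rightarrow> nat \<Rightarrow> (nat \<Rightarrow> real) \<Rightarrow> ennreal" where
  "mixed_integrand d F k v =
     (if 0 < remainder v k \<and> (\<forall>j\<in>{1..<k}. 0 < v j)
      then F (mixed_chart d k v) * ennreal (mixed_jacobian d k v) else 0)"

lemma gap_factor_self [simp]: "gap_factor v k k = 1"
  by (simp add: gap_factor_def)

lemma gap_factor_pos [simp]: "0 < gap_factor v k i"
  by (simp add: gap_factor_def)

lemma gap_factor_rec: "k < i \<Longrightarrow> gap_factor v k i = exp (- v k) * gap_factor v (Suc k) i"
  by (simp add: gap_factor_def sum.atLeast_Suc_lessThan exp_add[symmetric])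

lemma gap_total_pos: "k \<le> d \<Longrightarrow> 0 < gap_total d v k"
  unfolding gap_total_def by (intro sum_pos) auto

text \<open>Origin of the logistic form: \<open>v k\<close> enters only through
  \<open>exp (- v k)\<close>, since the total at \<open>Suc k\<close> involves later gaps
  alone.\<close>

lemma gap_total_rec:
  assumes "k < d"
  shows "gap_total d v k = 1 + exp (- v k) * gap_total d v (Suc k)"
proof -
  have "gap_total d v k = 1 + (\<Sum>i=Suc k..d. gap_factor v k i)"
    unfolding gap_total_def using assms by (simp add: sum.atLeast_Suc_atMost)
  also have "(\<Sum>i=Suc k..d. gap_factor v k i) = exp (- v k) * gap_total d v (Suc k)"
    unfolding gap_total_def sum_distrib_left by (intro sum.cong) (auto simp: gap_factor_rec)
  finally show ?thesis .
qed

lemma gap_total_self: "gap_total d v d = 1"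
  by (simp add: gap_total_def)

lemma remainder_upd: "k \<le> j \<Longrightarrow> remainder (v(j := t)) k = remainder v k"
  unfolding remainder_def by (intro arg_cong2[of _ _ _ _ "(-)"] sum.cong) auto

lemma remainder_Suc_upd: "1 \<le> k \<Longrightarrow> remainder (v(k := t)) (Suc k) = remainder v k - t"
  using remainder_upd[of k k v t] by (simp add: remainder_def)

lemma gap_factor_upd: "j < k \<Longrightarrow> gap_factor (v(j := t)) k i = gap_factor v k i"
  unfolding gap_factor_def by (intro arg_cong[of _ _ exp] arg_cong[of _ _ uminus] sum.cong) auto

lemma gap_total_upd: "j < k \<Longrightarrow> gap_total d (v(j := t)) k = gap_total d v k"
  by (simp add: gap_total_def gap_factor_upd)

lemma mixed_chart_first: "k \<in> {1..d} \<Longrightarrow> mixed_chart d k v k = remainder v k / gap_total d v k"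
  by (simp add: mixed_chart_def)

section \<open>Replacing component \<open>k\<close> by a log gap: chart and Jacobian\<close>

context
  fixes d k :: nat and v :: "nat \<Rightarrow> real" and c :: real
  assumes k: "1 \<le> k" "k < d"
  defines "c \<equiv> gap_total d v (Suc k)"
begin

lemma gap_total_upd_same: "gap_total d (v(k := u)) k = 1 + exp (- u) * c"
  using k by (simp add: gap_total_rec gap_total_upd c_def)

lemma gap_total_Suc_pos: "0 < c"
  using k by (simp add: c_def gap_total_pos)

lemma logistic_denominator_pos: "0 < 1 + exp (- u) * c"
  using gap_total_Suc_pos by (simp add: add_pos_pos)

text \<open>With \<open>y k\<close> the component at \<open>k\<close>, the mass left after it is
  \<open>y k * exp (- u) * c\<close>. Dividing by the later total \<open>c\<close> gives component
  \<open>k + 1\<close> as \<open>y k * exp (- u)\<close>, so \<open>u\<close> is the log gap in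
  front of the later ones.\<close>

lemma mixed_chart_step:
  "mixed_chart d (Suc k) (v(k := remainder v k / (1 + exp (- u) * c))) = mixed_chart d k (v(k := u))"
proof
  fix i
  let ?s = "remainder v k"
  have rem: "?s - ?s / (1 + exp (- u) * c) = ?s / (1 + exp (- u) * c) * exp (- u) * c"
    using logistic_denominator_pos[of u] by (simp add: field_simps)
  show "mixed_chart d (Suc k) (v(k := ?s / (1 + exp (- u) * c))) i = mixed_chart d k (v(k := u)) i"
    using k gap_total_Suc_pos
    by (cases i k rule: linorder_cases)
       (auto simp: mixed_chart_def gap_total_upd_same remainder_upd gap_total_upd remainder_Suc_upd
          gap_factor_rec gap_factor_upd rem c_def[symmetric])
qed

text \<open>The logistic derivative is \<open>y k * (s - y k) / s\<close>: \<open>s - y k\<close>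
  cancels the old denominator, \<open>y k\<close> joins the product and \<open>s\<close> is the new
  denominator.\<close>

lemma mixed_jacobian_step:
  assumes s: "0 < remainder v k"
  shows "mixed_jacobian d (Suc k) (v(k := remainder v k / (1 + exp (- u) * c))) *
      (remainder v k * (exp (- u) * c) / (1 + exp (- u) * c)\<^sup>2) = mixed_jacobian d k (v(k := u))"
proof -
  let ?s = "remainder v k" and ?D = "1 + exp (- u) * c"
  let ?P = "\<Prod>i=Suc k..d. mixed_chart d k (v(k := u)) i"
  have rem: "?s - ?s / ?D = ?s * (exp (- u) * c) / ?D"
    using logistic_denominator_pos[of u] by (simp add: field_simps)
  have first: "mixed_chart d k (v(k := u)) k = ?s / ?D"
    using k by (simp add: mixed_chart_first gap_total_upd_same remainder_upd)
  have "(\<Prod>i=k..d. mixed_chart d k (v(k := u)) i) = ?s / ?D * ?P"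
    using k by (simp add: prod.atLeast_Suc_atMost first)
  moreover have "?P / (?s * (exp (- u) * c) / ?D) * (?s * (exp (- u) * c) / ?D\<^sup>2) = ?s / ?D * ?P / ?s"
    using s gap_total_Suc_pos logistic_denominator_pos[of u] by (simp add: divide_simps power2_eq_square)
  ultimately show ?thesis
    unfolding mixed_jacobian_def mixed_chart_step using k
    by (simp add: remainder_Suc_upd rem remainder_upd)
qed

end

lemma mixed_jacobian_nonneg:
  assumes "1 \<le> k" "k \<le> d" "0 < remainder v k"
  shows "0 \<le> mixed_jacobian d k v"
  unfolding mixed_jacobian_def using assms gap_total_pos[of k d v]
  by (intro divide_nonneg_pos prod_nonneg)
     (auto simp: mixed_chart_def gap_factor_def intro!: mult_nonneg_nonneg divide_nonneg_nonneg)

section \<open>Measurability of charts and integrands\<close>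

lemma measurable_mixed_chart:
  assumes "1 \<le> k" "k \<le> d"
  shows "mixed_chart d k \<in> (\<Pi>\<^sub>M i\<in>{1..<d}. lborel) \<rightarrow>\<^sub>M (\<Pi>\<^sub>M i\<in>{1..d}. borel)"
proof -
  have comp: "(\<lambda>v. v j) \<in> borel_measurable (\<Pi>\<^sub>M i\<in>{1..<d}. lborel :: real measure)"
    if "j \<in> {1..<d}" for j
    using measurable_component_singleton[OF that, of "\<lambda>_. lborel"] by simp
  show ?thesis
    unfolding mixed_chart_def
  proof (rule measurable_restrict)
    fix i assume i: "i \<in> {1..d}"
    show "(\<lambda>v. if i < k then v i else remainder v k / gap_total d v k * gap_factor v k i)
        \<in> borel_measurable (\<Pi>\<^sub>M i\<in>{1..<d}. lborel)"
    proof (cases "i < k")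
      case True
      then show ?thesis using i assms(2) comp[of i] by simp
    next
      case False
      then show ?thesis
        unfolding remainder_def gap_total_def gap_factor_def if_not_P[OF False] using i assms
        by (intro borel_measurable_times borel_measurable_divide borel_measurable_diff
            borel_measurable_sum borel_measurable_exp measurable_const
            measurable_compose[OF _ borel_measurable_exp] borel_measurable_uminus comp) auto
    qed
  qed
qed

lemma measurable_mixed_integrand:
  assumes k: "1 \<le> k" "k \<le> d" and F: "F \<in> borel_measurable (\<Pi>\<^sub>M i\<in>{1..d}. borel)"
  shows "mixed_integrand d F k \<in> borel_measurable (\<Pi>\<^sub>M i\<in>{1..<d}. lborel)"
proof -
  have comp: "(\<lambda>v. v j) \<in> borel_measurable (\<Pi>\<^sub>M i\<in>{1..<d}. lborel :: real measure)"
    if "j \<in> {1..<d}" for j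
    using measurable_component_singleton[OF that, of "\<lambda>_. lborel"] by simp
  have rem [measurable]: "(\<lambda>v. remainder v k) \<in> borel_measurable (\<Pi>\<^sub>M i\<in>{1..<d}. lborel)"
    unfolding remainder_def using k
    by (intro borel_measurable_diff borel_measurable_sum comp) auto
  have chart: "(\<lambda>v. mixed_chart d k v i) \<in> borel_measurable (\<Pi>\<^sub>M i\<in>{1..<d}. lborel)" if "i \<in> {1..d}" for i
    using measurable_compose[OF measurable_mixed_chart measurable_component_singleton] that k by blast
  have jac [measurable]: "mixed_jacobian d k \<in> borel_measurable (\<Pi>\<^sub>M i\<in>{1..<d}. lborel)"
    unfolding mixed_jacobian_def using k
    by (intro borel_measurable_divide borel_measurable_prod chart rem) auto
  have [measurable]: "(\<lambda>v. F (mixed_chart d k v)) \<in> borel_measurable (\<Pi>\<^sub>M i\<in>{1..<d}. lborel)"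
    using measurable_compose[OF measurable_mixed_chart F] k by blast
  have [measurable]: "Measurable.pred (\<Pi>\<^sub>M i\<in>{1..<d}. lborel) (\<lambda>v. \<forall>j\<in>{1..<k}. (0::real) < v j)"
    using k by (intro pred_intros_finite borel_measurable_pred_less comp) auto
  show ?thesis
    unfolding mixed_integrand_def by measurable
qed

text \<open>Tonelli with coordinate \<open>k\<close> innermost: a change of variables in one
  coordinate, the others frozen, carries over to the product integral.\<close>

lemma nn_integral_PiM_cong_coordinate:
  fixes f g :: "('i \<Rightarrow> real) \<Rightarrow> ennreal"
  assumes "finite I" "k \<in> I"
    and "f \<in> borel_measurable (\<Pi>\<^sub>M i\<in>I. lborel)" "g \<in> borel_measurable (\<Pi>\<^sub>M i\<in>I. lborel)"
    and "\<And>v. v \<in> space (\<Pi>\<^sub>M i\<in>I - {k}. lborel) \<Longrightarrow>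
      (\<integral>\<^sup>+t. f (v(k := t)) \<partial>lborel) = (\<integral>\<^sup>+t. g (v(k := t)) \<partial>lborel)"
  shows "(\<integral>\<^sup>+v. f v \<partial>(\<Pi>\<^sub>M i\<in>I. lborel)) = (\<integral>\<^sup>+v. g v \<partial>(\<Pi>\<^sub>M i\<in>I. lborel))"
proof -
  interpret product_sigma_finite "\<lambda>_::'i. lborel :: real measure" ..
  have I: "I = insert k (I - {k})" using assms(2) by blast
  have "(\<integral>\<^sup>+v. h v \<partial>(\<Pi>\<^sub>M i\<in>I. lborel)) =
      (\<integral>\<^sup>+v. \<integral>\<^sup>+t. h (v(k := t)) \<partial>lborel \<partial>(\<Pi>\<^sub>M i\<in>I - {k}. lborel))"
    if "h \<in> borel_measurable (\<Pi>\<^sub>M i\<in>I. lborel)" for h :: "('i \<Rightarrow> real) \<Rightarrow> ennreal"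
    using product_nn_integral_insert[of "I - {k}" k h] that assms(1) I by simp
  then show ?thesis using assms(3-5) by (simp cong: nn_integral_cong)
qed

text \<open>With the other coordinates frozen, coordinate \<open>k\<close> is confined at stage
  \<open>Suc k\<close> to \<open>{0<..<s}\<close>, the range of the logistic map, and is
  unrestricted at stage \<open>k\<close>.\<close>

lemma nn_integral_mixed_integrand_step:
  assumes k: "1 \<le> k" "k < d" and F: "F \<in> borel_measurable (\<Pi>\<^sub>M i\<in>{1..d}. borel)"
  shows "(\<integral>\<^sup>+v. mixed_integrand d F (Suc k) v \<partial>(\<Pi>\<^sub>M i\<in>{1..<d}. lborel)) =
    (\<integral>\<^sup>+v. mixed_integrand d F k v \<partial>(\<Pi>\<^sub>M i\<in>{1..<d}. lborel))"
proof (rule nn_integral_PiM_cong_coordinate[where k = k])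
  fix v assume v: "v \<in> space (\<Pi>\<^sub>M i\<in>{1..<d} - {k}. lborel :: real measure)"
  define s where "s = remainder v k"
  define c where "c = gap_total d v (Suc k)"
  define P where "P \<longleftrightarrow> (\<forall>j\<in>{1..<k}. 0 < v j)"
  have P_upd: "(\<forall>j\<in>{1..<k}. 0 < (v(k := t)) j) \<longleftrightarrow> P" for t
    unfolding P_def by auto
  have c: "0 < c" using k by (simp add: c_def gap_total_pos)
  have P_Suc: "(\<forall>j\<in>{1..<Suc k}. 0 < (v(k := t)) j) \<longleftrightarrow> P \<and> 0 < t" for t
  proof -
    have "{1..<Suc k} = insert k {1..<k}" using k by auto
    then show ?thesis unfolding P_def by auto
  qed
  have dom: "mixed_integrand d F (Suc k) (v(k := t)) =
      (if P \<and> 0 < t \<and> t < s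
       then F (mixed_chart d (Suc k) (v(k := t))) * ennreal (mixed_jacobian d (Suc k) (v(k := t)))
       else 0)" for t
    using k unfolding mixed_integrand_def P_Suc by (auto simp: remainder_Suc_upd s_def)
  show "(\<integral>\<^sup>+t. mixed_integrand d F (Suc k) (v(k := t)) \<partial>lborel) =
      (\<integral>\<^sup>+t. mixed_integrand d F k (v(k := t)) \<partial>lborel)"
  proof (cases "P \<and> 0 < s")
    \<comment> \<open>Either an earlier component is not positive or no mass remains; both
      integrands then vanish identically.\<close>
    case False
    then have "mixed_integrand d F (Suc k) (v(k := t)) = 0" "mixed_integrand d F k (v(k := t)) = 0" for t
      using k unfolding dom mixed_integrand_def[of d F k] P_upd
      by (auto simp: remainder_upd s_def[symmetric] simp del: fun_upd_apply)
    then show ?thesis by simp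
  next
    case True
    then have s: "0 < s" and P: P by auto
    let ?h = "\<lambda>t. mixed_integrand d F (Suc k) (v(k := t))"
    have "insert k ({1..<d} - {k}) = {1..<d}" using k by auto
    with measurable_component_update[OF v, of k] have "(\<lambda>t. v(k := t)) \<in> lborel \<rightarrow>\<^sub>M (\<Pi>\<^sub>M i\<in>{1..<d}. lborel :: real measure)"
      by simp
    from measurable_compose[OF this measurable_mixed_integrand[OF _ _ F]]
    have h: "?h \<in> borel_measurable borel" using k by simp
    have "(\<integral>\<^sup>+t. ?h t \<partial>lborel) = (\<integral>\<^sup>+t. ?h t * indicator {0<..<s} t \<partial>lborel)"
      by (intro nn_integral_cong) (auto simp: dom)
    also have "\<dots> = (\<integral>\<^sup>+u. ?h (s / (1 + exp (- u) * c)) *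
        ennreal (s * (exp (- u) * c) / (1 + exp (- u) * c)\<^sup>2) \<partial>lborel)"
      by (rule nn_integral_logistic_substitution[OF h s c])
    also have "\<dots> = (\<integral>\<^sup>+u. mixed_integrand d F k (v(k := u)) \<partial>lborel)"
    proof (intro nn_integral_cong)
      fix u :: real
      \<comment> \<open>A denominator above \<open>1\<close> puts \<open>?t\<close> strictly between
        \<open>0\<close> and \<open>s\<close>, where the Jacobian is nonnegative and
        \<open>ennreal\<close> is multiplicative.\<close>
      have D: "1 < 1 + exp (- u) * c" using c by simp
      let ?t = "s / (1 + exp (- u) * c)"
      have "0 < ?t" using D s by (intro divide_pos_pos) linarith+
      moreover have "?t < s / 1" using D s by (intro divide_strict_left_mono, unfold mult_1_right) linarith+
      ultimately have t: "0 < ?t" "?t < s" by simp_all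
      have "0 \<le> mixed_jacobian d (Suc k) (v(k := ?t))"
        using k t by (intro mixed_jacobian_nonneg) (auto simp: remainder_Suc_upd s_def)
      moreover have "0 \<le> s * (exp (- u) * c) / (1 + exp (- u) * c)\<^sup>2"
        using s c by simp
      ultimately have "?h ?t * ennreal (s * (exp (- u) * c) / (1 + exp (- u) * c)\<^sup>2) =
        F (mixed_chart d (Suc k) (v(k := ?t))) * ennreal (mixed_jacobian d (Suc k) (v(k := ?t)) *
          (s * (exp (- u) * c) / (1 + exp (- u) * c)\<^sup>2))"
        unfolding dom using P t by (subst ennreal_mult) (simp_all only: mult.assoc simp_thms if_True)
      also have "\<dots> = F (mixed_chart d k (v(k := u))) * ennreal (mixed_jacobian d k (v(k := u)))"
        using mixed_chart_step[OF k, of v u] mixed_jacobian_step[OF k, of v u] s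
        unfolding s_def c_def by simp
      also have "\<dots> = mixed_integrand d F k (v(k := u))"
        using P s k unfolding mixed_integrand_def P_upd by (simp add: remainder_upd s_def)
      finally show "?h ?t * ennreal (s * (exp (- u) * c) / (1 + exp (- u) * c)\<^sup>2) =
        mixed_integrand d F k (v(k := u))" .
    qed
    finally show ?thesis .
  qed
qed (use k in \<open>auto intro!: measurable_mixed_integrand[OF _ _ F, simplified]\<close>)

lemma nn_integral_mixed_integrand:
  assumes "1 \<le> d" and F: "F \<in> borel_measurable (\<Pi>\<^sub>M i\<in>{1..d}. borel)"
  shows "(\<integral>\<^sup>+v. mixed_integrand d F d v \<partial>(\<Pi>\<^sub>M i\<in>{1..<d}. lborel)) =
    (\<integral>\<^sup>+v. mixed_integrand d F 1 v \<partial>(\<Pi>\<^sub>M i\<in>{1..<d}. lborel))"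
  using assms(1)
  by (induction rule: inc_induct[where P = "\<lambda>k. (\<integral>\<^sup>+v. mixed_integrand d F d v \<partial>(\<Pi>\<^sub>M i\<in>{1..<d}. lborel)) =
        (\<integral>\<^sup>+v. mixed_integrand d F k v \<partial>(\<Pi>\<^sub>M i\<in>{1..<d}. lborel))"])
     (simp_all add: nn_integral_mixed_integrand_step[OF _ _ F, simplified])

subsection \<open>Integrals of functions of the log gaps\<close>

lemma borel_measurable_component:
  "i \<in> I \<Longrightarrow> (\<lambda>y. y i) \<in> borel_measurable (\<Pi>\<^sub>M i\<in>I. borel)"
  using measurable_component_singleton[of i I "\<lambda>_. borel"] by simp

lemma sets_ordered_simplex:
  assumes "1 \<le> d"
  shows "ordered_simplex d \<in> sets (\<Pi>\<^sub>M i\<in>{1..d}. borel)"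
proof -
  have "{y \<in> space (\<Pi>\<^sub>M i\<in>{1..d}. borel).
      (\<forall>k\<in>{2..d}. y k \<le> y (k - 1)) \<and> 0 \<le> y d \<and> (\<Sum>k=1..d. y k) = (1::real)} \<in> sets (\<Pi>\<^sub>M i\<in>{1..d}. borel)"
    using assms
    by (intro sets.sets_Collect_conj sets.sets_Collect_finite_All borel_measurable_le borel_measurable_eq
        borel_measurable_sum borel_measurable_component measurable_const) auto
  then show ?thesis
    by (simp add: ordered_simplex_def space_PiM)
qed

lemma measurable_grd_weight: "grd_weight d a \<in> borel_measurable (\<Pi>\<^sub>M i\<in>{1..d}. borel)"
  unfolding grd_weight_def
  by (intro borel_measurable_prod powr_real_measurable borel_measurable_component borel_measurable_const)

lemma measurable_log_gap:
  "k \<in> {2..d} \<Longrightarrow> log_gap k \<in> borel_measurable (\<Pi>\<^sub>M i\<in>{1..d}. borel)"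
  unfolding log_gap_def
  by (intro borel_measurable_diff borel_measurable_ln borel_measurable_component)
     auto

lemma measurable_simplex_measure:
  "f \<in> borel_measurable (\<Pi>\<^sub>M i\<in>{1..d}. borel) \<Longrightarrow> f \<in> borel_measurable (simplex_measure d)"
  unfolding simplex_measure_def by (intro measurable_restrict_space1) simp

lemma mixed_chart_eq_simplex_chart: "mixed_chart d d = simplex_chart d"
  by (auto simp: mixed_chart_def simplex_chart_def fun_eq_iff remainder_def gap_total_self)

lemma nn_integral_simplex_measure:
  assumes d: "1 \<le> d" and F: "F \<in> borel_measurable (\<Pi>\<^sub>M i\<in>{1..d}. borel)"
  shows "(\<integral>\<^sup>+y. F y \<partial>simplex_measure d) =
    (\<integral>\<^sup>+v. F (simplex_chart d v) * indicator (ordered_simplex d) (simplex_chart d v)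
      \<partial>(\<Pi>\<^sub>M i\<in>{1..<d}. lborel))"
proof -
  have "simplex_chart d \<in> (\<Pi>\<^sub>M i\<in>{1..<d}. lborel) \<rightarrow>\<^sub>M (\<Pi>\<^sub>M i\<in>{1..d}. borel)"
    using measurable_mixed_chart[of d d] d by (simp add: mixed_chart_eq_simplex_chart)
  then show ?thesis
    unfolding simplex_measure_def using d F sets_ordered_simplex[of d]
    by (subst nn_integral_restrict_space) (auto intro!: nn_integral_distr)
qed

lemma space_simplex_measure: "1 \<le> d \<Longrightarrow> space (simplex_measure d) = ordered_simplex d"
  using sets.sets_into_space[OF sets_ordered_simplex[of d]]
  by (auto simp: simplex_measure_def space_restrict_space)

lemma grd_weight_nonneg: "0 \<le> grd_weight d a y"
  by (simp add: grd_weight_def prod_nonneg)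

lemma ordered_simplex_antimono:
  assumes "y \<in> ordered_simplex d" "1 \<le> i" "i \<le> j" "j \<le> d"
  shows "y j \<le> y i"
  using assms(3,4)
proof (induction j rule: dec_induct)
  case (step n)
  then have "y (Suc n) \<le> y n"
    using assms(1,2) by (auto simp: ordered_simplex_def dest!: bspec[of _ _ "Suc n"])
  then show ?case using step by simp
qed simp

lemma ordered_simplex_nonneg: "y \<in> ordered_simplex d \<Longrightarrow> i \<in> {1..d} \<Longrightarrow> 0 \<le> y i"
  using ordered_simplex_antimono[of y d i d] by (auto simp: ordered_simplex_def)

lemma grd_weight_pos_imp: "grd_weight d a y \<noteq> 0 \<Longrightarrow> i \<in> {1..d} \<Longrightarrow> y i \<noteq> 0"
  by (auto simp: grd_weight_def)

lemma log_gap_nonneg: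
  assumes "y \<in> ordered_simplex d" "grd_weight d a y \<noteq> 0" "k \<in> {2..d}"
  shows "0 \<le> log_gap k y"
proof -
  have "0 < y k" "y k \<le> y (k - 1)"
    using ordered_simplex_nonneg[OF assms(1), of k] grd_weight_pos_imp[OF assms(2), of k] assms(1,3)
    by (auto simp: ordered_simplex_def)
  then show ?thesis by (simp add: log_gap_def)
qed

section \<open>Exponential form of the density in the log gaps\<close>

lemma sum_tail_sum:
  fixes c w :: "nat \<Rightarrow> real"
  shows "(\<Sum>i=1..d. c i * (\<Sum>j=1..<i. w j)) = (\<Sum>j=1..<d. w j * tail_sum d c (Suc j))"
proof -
  have "(\<Sum>i=1..d. c i * (\<Sum>j=1..<i. w j)) = (\<Sum>i\<in>{1..d}. \<Sum>j | j \<in> {1..<d} \<and> j < i. c i * w j)"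
    unfolding sum_distrib_left by (intro sum.cong) auto
  \<comment> \<open>Interchanging the sums over pairs \<open>j < i\<close> lets \<open>w j\<close>
    collect all \<open>c i\<close> with \<open>i > j\<close>, the tail sum from
    \<open>Suc j\<close>.\<close>
  also have "\<dots> = (\<Sum>j\<in>{1..<d}. \<Sum>i | i \<in> {1..d} \<and> j < i. c i * w j)"
    by (rule sum.swap_restrict) auto
  also have "\<dots> = (\<Sum>j=1..<d. w j * tail_sum d c (Suc j))"
    unfolding tail_sum_def sum_distrib_left by (intro sum.cong) auto
  finally show ?thesis .
qed

text \<open>Taking logarithms gives the double sum of \<open>sum_tail_sum\<close>; this is how tail
  sums become the rates of the log gaps.\<close>

lemma prod_powr_gap_factor:
  "(\<Prod>i=1..d. gap_factor v 1 i powr c i) = exp (- (\<Sum>j=1..<d. v j * tail_sum d c (Suc j)))"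
proof -
  have "(\<Prod>i=1..d. gap_factor v 1 i powr c i) = (\<Prod>i=1..d. exp (- (c i * (\<Sum>j=1..<i. v j))))"
    by (intro prod.cong) (simp_all add: gap_factor_def powr_def)
  also have "\<dots> = exp (- (\<Sum>i=1..d. c i * (\<Sum>j=1..<i. v j)))"
    by (simp add: exp_sum[symmetric] sum_negf)
  finally show ?thesis by (simp only: sum_tail_sum)
qed

lemma multi_indices_eq: "multi_indices d M = {m \<in> {1..d} \<rightarrow>\<^sub>E UNIV. sum m {1..d} = M}"
  by (simp add: multi_indices_def tail_sum_def)

lemma finite_multi_indices: "finite (multi_indices d M)"
  unfolding multi_indices_eq by (rule finite_PiE_sum_eq) simp

lemma multi_indices_nonempty: "1 \<le> d \<Longrightarrow> multi_indices d M \<noteq> {}"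
proof -
  assume d: "1 \<le> d"
  have "(\<lambda>i\<in>{1..d}. if i = 1 then M else 0) \<in> multi_indices d M"
    using d by (auto simp: multi_indices_eq)
  then show ?thesis by blast
qed

lemma multinomial_pos: "0 < multinomial d M m"
  by (simp add: multinomial_def prod_pos)

text \<open>The total is a sum of ratios \<open>y i / y 1\<close>, each the exponential of a linear
  form in the gaps; hence so is every monomial of the multinomial expansion.\<close>

lemma gap_total_power:
  "gap_total d v 1 ^ M = (\<Sum>m\<in>multi_indices d M. multinomial d M m *
     exp (- (\<Sum>j=1..<d. v j * real (tail_sum d m (Suc j)))))"
proof -
  have "(\<Prod>i=1..d. gap_factor v 1 i ^ m i) = exp (- (\<Sum>j=1..<d. v j * real (tail_sum d m (Suc j))))" for m
    using prod_powr_gap_factor[of v "\<lambda>i. real (m i)" d]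
    by (simp add: powr_realpow tail_sum_def del: One_nat_def)
  then show ?thesis
    unfolding gap_total_def multi_indices_eq multinomial_def
    by (subst multinomial_theorem) simp_all
qed

text \<open>The product of the components raises each exponent \<open>a i - 1\<close> to
  \<open>a i\<close>. As \<open>y i = gap_factor v 1 i / gap_total d v 1\<close>, the total acquires
  the exponent \<open>- tail_sum d a 1 = M\<close>, a natural number, and can be expanded.\<close>

lemma gap_chart_integrand:
  fixes v :: "nat \<Rightarrow> real"
  assumes "1 \<le> d" "tail_sum d a 1 = - real M"
  defines "y \<equiv> mixed_chart d 1 v"
  shows "grd_weight d a y * (\<Prod>i=1..d. y i) = (\<Sum>m\<in>multi_indices d M. multinomial d M m *
     (\<Prod>j=1..<d. exp (- (tail_sum d a (Suc j) + real (tail_sum d m (Suc j))) * v j)))"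
proof -
  let ?S = "gap_total d v 1"
  have S: "0 < ?S" using assms(1) by (simp add: gap_total_pos)
  have y: "y i = gap_factor v 1 i / ?S" if "i \<in> {1..d}" for i
    using that by (simp add: y_def mixed_chart_def remainder_def)
  have "grd_weight d a y * (\<Prod>i=1..d. y i) = (\<Prod>i=1..d. y i powr a i)"
    unfolding grd_weight_def prod.distrib[symmetric]
  proof (intro prod.cong refl)
    fix i assume "i \<in> {1..d}"
    then have "0 < y i" using S by (simp add: y)
    then show "y i powr (a i - 1) * y i = y i powr a i"
      by (simp add: powr_diff)
  qed
  also have "\<dots> = (\<Prod>i=1..d. gap_factor v 1 i powr a i * ?S powr (- a i))"
    using S by (intro prod.cong) (auto simp: y powr_divide powr_minus field_simps less_imp_le)
  also have "\<dots> = (\<Prod>i=1..d. gap_factor v 1 i powr a i) * ?S powr (\<Sum>i=1..d. - a i)"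
    using S by (simp add: prod.distrib powr_sum)
  also have "(\<Sum>i=1..d. - a i) = real M"
    using assms(2) by (simp add: tail_sum_def sum_negf)
  also have "?S powr real M = ?S ^ M"
    using S by (simp add: powr_realpow)
  also have "(\<Prod>i=1..d. gap_factor v 1 i powr a i) * ?S ^ M = (\<Sum>m\<in>multi_indices d M. multinomial d M m *
     exp (- (\<Sum>j=1..<d. v j * tail_sum d a (Suc j)) - (\<Sum>j=1..<d. v j * real (tail_sum d m (Suc j)))))"
    unfolding prod_powr_gap_factor gap_total_power sum_distrib_left
    by (intro sum.cong) (simp_all add: exp_diff exp_minus field_simps)
  also have "\<dots> = (\<Sum>m\<in>multi_indices d M. multinomial d M m *
     exp (\<Sum>j=1..<d. - (tail_sum d a (Suc j) + real (tail_sum d m (Suc j))) * v j))"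
    unfolding sum_negf[symmetric] sum_subtractf[symmetric] by (simp add: algebra_simps)
  finally show ?thesis
    by (simp add: exp_sum)
qed

text \<open>Positivity and total mass \<open>1\<close> hold for all gaps; only the ordering
  constrains them, and \<open>y (j + 1) \<le> y j\<close> says \<open>0 \<le> v j\<close>.\<close>

lemma gap_chart_ordered_simplex:
  assumes "1 \<le> d"
  shows "mixed_chart d 1 v \<in> ordered_simplex d \<longleftrightarrow> (\<forall>j\<in>{1..<d}. 0 \<le> v j)"
proof -
  let ?y = "mixed_chart d 1 v" and ?S = "gap_total d v 1"
  have S: "0 < ?S" using assms by (simp add: gap_total_pos)
  have y: "?y i = gap_factor v 1 i / ?S" if "i \<in> {1..d}" for i
    using that by (simp add: mixed_chart_def remainder_def)
  have ext: "?y \<in> {1..d} \<rightarrow>\<^sub>E UNIV" by (simp add: mixed_chart_def)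
  have "(\<Sum>i=1..d. ?y i) = (\<Sum>i=1..d. gap_factor v 1 i / ?S)"
    by (intro sum.cong refl y)
  also have "\<dots> = 1" using S by (simp add: sum_divide_distrib[symmetric] gap_total_def[symmetric] del: One_nat_def)
  finally have sum: "(\<Sum>i=1..d. ?y i) = 1" .
  have step: "?y (Suc j) \<le> ?y j \<longleftrightarrow> 0 \<le> v j" if "j \<in> {1..<d}" for j
    using that S y[of j] y[of "Suc j"] by (simp add: gap_factor_def divide_le_cancel)
  have "(\<forall>k\<in>{2..d}. ?y k \<le> ?y (k - 1)) \<longleftrightarrow> (\<forall>j\<in>{1..<d}. ?y (Suc j) \<le> ?y j)"
  proof (intro iffI ballI)
    fix j assume "\<forall>k\<in>{2..d}. ?y k \<le> ?y (k - 1)" "j \<in> {1..<d}"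
    then show "?y (Suc j) \<le> ?y j" by (auto dest: bspec[of _ _ "Suc j"])
  next
    fix k assume *: "\<forall>j\<in>{1..<d}. ?y (Suc j) \<le> ?y j" "k \<in> {2..d}"
    then have "?y (Suc (k - 1)) \<le> ?y (k - 1)" by (intro bspec[OF *(1)]) auto
    then show "?y k \<le> ?y (k - 1)" using *(2) by simp
  qed
  moreover have "0 \<le> ?y d" using S assms y[of d] by (simp add: less_imp_le)
  ultimately show ?thesis
    unfolding ordered_simplex_def using ext sum step by auto
qed

lemma log_gap_gap_chart:
  assumes "j \<in> {1..<d}"
  shows "log_gap (Suc j) (mixed_chart d 1 v) = v j"
proof -
  have "0 < gap_total d v 1" using assms by (intro gap_total_pos) auto
  then show ?thesis
    using assms by (simp add: log_gap_def mixed_chart_def remainder_def ln_mult ln_div)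
      (simp add: gap_factor_def)
qed

lemma prod_atLeast_two_shift: "(\<Prod>k=2..d. f k) = (\<Prod>j=1..<d. f (Suc j))"
  by (rule prod.reindex_bij_witness[of _ Suc "\<lambda>k. k - 1"]) auto

text \<open>In gap coordinates the simplex is an orthant, the density a combination of products of
  exponentials and the test function a product, so Tonelli factorises each term.\<close>

lemma nn_integral_grd_weight_log_gaps:
  fixes g :: "nat \<Rightarrow> real \<Rightarrow> ennreal"
  assumes d: "1 \<le> d" and a: "tail_sum d a 1 = - real M"
    and g: "\<And>k. g k \<in> borel_measurable borel"
  shows "(\<integral>\<^sup>+y. ennreal (grd_weight d a y) * (\<Prod>k=2..d. g k (log_gap k y)) \<partial>simplex_measure d) =
    (\<Sum>m\<in>multi_indices d M. ennreal (multinomial d M m) * (\<Prod>k=2..d.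
       \<integral>\<^sup>+z. g k z * ennreal (exp (- (tail_sum d a k + real (tail_sum d m k)) * z)) * indicator {0..} z \<partial>lborel))"
proof -
  interpret product_sigma_finite "\<lambda>_::nat. lborel :: real measure" ..
  define F where "F y = ennreal (grd_weight d a y) * (\<Prod>k=2..d. g k (log_gap k y))" for y
  \<comment> \<open>The indicator is absorbed into the integrand because the stage changes concern
    functions on the whole space.\<close>
  define H where "H y = F y * indicator (ordered_simplex d) y" for y
  have F: "F \<in> borel_measurable (\<Pi>\<^sub>M i\<in>{1..d}. borel)"
    unfolding F_def
    by (intro borel_measurable_times_ennreal borel_measurable_prod_ennreal measurable_compose[OF _ g]
        measurable_compose[OF _ measurable_ennreal] measurable_grd_weight measurable_log_gap)
  have H: "H \<in> borel_measurable (\<Pi>\<^sub>M i\<in>{1..d}. borel)"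
    unfolding H_def using F sets_ordered_simplex[OF d]
    by (intro borel_measurable_times_ennreal borel_measurable_indicator)
  \<comment> \<open>Coordinate \<open>j\<close> is the gap \<open>Z\<close> with index
    \<open>Suc j\<close>, hence the shifted tail sums.\<close>
  define w where "w m j z = g (Suc j) z *
      ennreal (exp (- (tail_sum d a (Suc j) + real (tail_sum d m (Suc j))) * z)) * indicator {0..} z" for m j z
  have w: "w m j \<in> borel_measurable borel" for m j
    unfolding w_def using g by (intro borel_measurable_times_ennreal measurable_compose[OF _ measurable_ennreal]) auto
  have "(\<integral>\<^sup>+y. F y \<partial>simplex_measure d) = (\<integral>\<^sup>+v. H (simplex_chart d v) \<partial>(\<Pi>\<^sub>M i\<in>{1..<d}. lborel))"
    unfolding H_def by (rule nn_integral_simplex_measure[OF d F])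
  also have "\<dots> = (\<integral>\<^sup>+v. mixed_integrand d H d v \<partial>(\<Pi>\<^sub>M i\<in>{1..<d}. lborel))"
  proof (intro nn_integral_cong)
    fix v :: "nat \<Rightarrow> real"
    let ?y = "simplex_chart d v"
    show "H ?y = mixed_integrand d H d v"
    proof (cases "0 < remainder v d \<and> (\<forall>j\<in>{1..<d}. 0 < v j)")
      case True
      then have "mixed_jacobian d d v = 1"
        using d by (simp add: mixed_jacobian_def mixed_chart_def gap_total_self)
      then show ?thesis using True by (simp add: mixed_integrand_def mixed_chart_eq_simplex_chart)
    next
      \<comment> \<open>Points of the simplex with a vanishing component have weight
        \<open>0\<close>, as \<open>0 powr x = 0\<close>, so restricting to positive components
        loses nothing.\<close>
      case False
      have "H ?y = 0"
      proof (rule ccontr)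
        assume "H ?y \<noteq> 0"
        then have y: "?y \<in> ordered_simplex d" "grd_weight d a ?y \<noteq> 0"
          by (auto simp: H_def F_def split: split_indicator_asm)
        have pos: "0 < ?y i" if "i \<in> {1..d}" for i
          using ordered_simplex_nonneg[OF y(1) that] grd_weight_pos_imp[OF y(2) that] by simp
        have "0 < v j" if "j \<in> {1..<d}" for j
          using pos[of j] that by (simp add: simplex_chart_def)
        moreover have "0 < remainder v d"
          using pos[of d] d by (simp add: simplex_chart_def remainder_def)
        ultimately show False using False by blast
      qed
      then show ?thesis unfolding mixed_integrand_def if_not_P[OF False] .
    qed
  qed
  also have "\<dots> = (\<integral>\<^sup>+v. mixed_integrand d H 1 v \<partial>(\<Pi>\<^sub>M i\<in>{1..<d}. lborel))"
    by (rule nn_integral_mixed_integrand[OF d H])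
  also have "\<dots> = (\<integral>\<^sup>+v. (\<Sum>m\<in>multi_indices d M. ennreal (multinomial d M m) * (\<Prod>j\<in>{1..<d}. w m j (v j)))
      \<partial>(\<Pi>\<^sub>M i\<in>{1..<d}. lborel))"
  proof (intro nn_integral_cong)
    fix v :: "nat \<Rightarrow> real"
    let ?y = "mixed_chart d 1 v"
    let ?e = "\<lambda>m j. exp (- (tail_sum d a (Suc j) + real (tail_sum d m (Suc j))) * v j)"
    have jac: "mixed_jacobian d 1 v = (\<Prod>i=1..d. ?y i)"
      by (simp add: mixed_jacobian_def remainder_def)
    have jac0: "0 \<le> mixed_jacobian d 1 v"
      using d by (intro mixed_jacobian_nonneg) (auto simp: remainder_def)
    have "mixed_integrand d H 1 v = H ?y * ennreal (mixed_jacobian d 1 v)"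
      by (simp add: mixed_integrand_def remainder_def)
    also have "\<dots> = indicator (ordered_simplex d) ?y * (\<Prod>j\<in>{1..<d}. g (Suc j) (v j)) *
        ennreal (grd_weight d a ?y * mixed_jacobian d 1 v)"
      unfolding H_def F_def prod_atLeast_two_shift using jac0
      by (simp add: log_gap_gap_chart ennreal_mult grd_weight_nonneg mult_ac del: One_nat_def)
    also have "indicator (ordered_simplex d) ?y = (\<Prod>j\<in>{1..<d}. indicator {0..} (v j) :: ennreal)"
      using gap_chart_ordered_simplex[OF d, of v] by (auto simp: indicator_def)
    also have "ennreal (grd_weight d a ?y * mixed_jacobian d 1 v) =
        (\<Sum>m\<in>multi_indices d M. ennreal (multinomial d M m) * (\<Prod>j\<in>{1..<d}. ennreal (?e m j)))"
      unfolding jac gap_chart_integrand[OF d a]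
      by (subst sum_ennreal[symmetric])
         (auto simp: ennreal_mult prod_ennreal less_imp_le[OF multinomial_pos] prod_nonneg)
    finally show "mixed_integrand d H 1 v =
        (\<Sum>m\<in>multi_indices d M. ennreal (multinomial d M m) * (\<Prod>j\<in>{1..<d}. w m j (v j)))"
      by (simp add: sum_distrib_left w_def prod.distrib mult_ac)
  qed
  also have "\<dots> = (\<Sum>m\<in>multi_indices d M. ennreal (multinomial d M m) *
      (\<integral>\<^sup>+v. (\<Prod>j\<in>{1..<d}. w m j (v j)) \<partial>(\<Pi>\<^sub>M i\<in>{1..<d}. lborel)))"
  proof -
    have meas: "(\<lambda>v. \<Prod>j\<in>{1..<d}. w m j (v j)) \<in> borel_measurable (\<Pi>\<^sub>M i\<in>{1..<d}. lborel)" for m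
    proof (intro borel_measurable_prod_ennreal measurable_compose[OF _ w])
      fix j assume "j \<in> {1..<d}"
      then show "(\<lambda>v. v j) \<in> borel_measurable (\<Pi>\<^sub>M i\<in>{1..<d}. lborel :: real measure)"
        using measurable_component_singleton[of j "{1..<d}" "\<lambda>_. lborel"] by simp
    qed
    show ?thesis
      using meas by (subst nn_integral_sum) (auto intro!: sum.cong nn_integral_cmult)
  qed
  also have "\<dots> = (\<Sum>m\<in>multi_indices d M. ennreal (multinomial d M m) *
      (\<Prod>j\<in>{1..<d}. \<integral>\<^sup>+z. w m j z \<partial>lborel))"
    using w by (subst product_nn_integral_prod) auto
  finally show ?thesis
    unfolding F_def w_def prod_atLeast_two_shift .
qed

section \<open>One-dimensional integrals and the normalising constant\<close>

lemma nn_integral_power_exp: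
  fixes c :: real
  assumes "0 < c"
  shows "(\<integral>\<^sup>+z. ennreal (z ^ n) * ennreal (exp (- c * z)) * indicator {0..} z \<partial>lborel) =
    ennreal (fact n / c ^ (n + 1))"
proof -
  \<comment> \<open>\<open>erlang_density 0 c\<close> is the exponential density
    \<open>c * exp (- c * z)\<close> on \<open>z \<ge> 0\<close>; its factor \<open>c\<close> is
    divided out.\<close>
  have "ennreal (z ^ n) * ennreal (exp (- c * z)) * indicator {0..} z =
      ennreal (1 / c) * ennreal (erlang_density 0 c z * z ^ n)" for z
    using assms
    by (auto simp: erlang_density_def ennreal_mult[symmetric] split: split_indicator)
  then have "(\<integral>\<^sup>+z. ennreal (z ^ n) * ennreal (exp (- c * z)) * indicator {0..} z \<partial>lborel) =
      ennreal (1 / c) * (\<integral>\<^sup>+z. ennreal (erlang_density 0 c z * z ^ n) \<partial>lborel)"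
    by (simp add: nn_integral_cmult)
  also have "\<dots> = ennreal (fact n / c ^ (n + 1))"
    unfolding nn_integral_erlang_ith_moment[OF assms] using assms
    by (simp add: ennreal_mult[symmetric])
  finally show ?thesis .
qed

text \<open>Common shape of normaliser, moment generating function and moments; \<open>L m k\<close>
  stands for the integral over gap \<open>k\<close> in the term of \<open>m\<close>.\<close>

definition gap_sum :: "nat \<Rightarrow> nat \<Rightarrow> ((nat \<Rightarrow> nat) \<Rightarrow> nat \<Rightarrow> real) \<Rightarrow> real" where
  "gap_sum d M L = (\<Sum>m\<in>multi_indices d M. multinomial d M m * (\<Prod>k=2..d. L m k))"

text \<open>The real value of \<open>grd_const d a\<close> when the components of \<open>a\<close>
  sum to \<open>- M\<close>.\<close>

definition grd_normalizer :: "nat \<Rightarrow> nat \<Rightarrow> (nat \<Rightarrow> real) \<Rightarrow> real" where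
  "grd_normalizer d M a = gap_sum d M (\<lambda>m k. 1 / (tail_sum d a k + real (tail_sum d m k)))"

lemma gap_sum_nonneg:
  "(\<And>m k. k \<in> {2..d} \<Longrightarrow> 0 \<le> L m k) \<Longrightarrow> 0 \<le> gap_sum d M L"
  unfolding gap_sum_def
  by (intro sum_nonneg mult_nonneg_nonneg prod_nonneg less_imp_le[OF multinomial_pos]) auto

lemma gap_sum_pos:
  "1 \<le> d \<Longrightarrow> (\<And>m k. k \<in> {2..d} \<Longrightarrow> 0 < L m k) \<Longrightarrow> 0 < gap_sum d M L"
  unfolding gap_sum_def
  by (intro sum_pos mult_pos_pos prod_pos multinomial_pos finite_multi_indices multi_indices_nonempty) auto

lemma gap_sum_mult:
  "gap_sum d M (\<lambda>m k. c k * L m k) = (\<Prod>k=2..d. c k) * gap_sum d M L"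
  by (simp add: gap_sum_def prod.distrib sum_distrib_left mult_ac)

lemma nn_integral_grd_weight_gap_sum:
  fixes g :: "nat \<Rightarrow> real \<Rightarrow> ennreal"
  assumes d: "1 \<le> d" and a: "tail_sum d a 1 = - real M"
    and g: "\<And>k. g k \<in> borel_measurable borel"
    and nonneg: "\<And>m k. k \<in> {2..d} \<Longrightarrow> 0 \<le> L m k"
    and L: "\<And>m k. k \<in> {2..d} \<Longrightarrow>
      (\<integral>\<^sup>+z. g k z * ennreal (exp (- (tail_sum d a k + real (tail_sum d m k)) * z)) * indicator {0..} z \<partial>lborel)
        = ennreal (L m k)"
  shows "(\<integral>\<^sup>+y. ennreal (grd_weight d a y) * (\<Prod>k=2..d. g k (log_gap k y)) \<partial>simplex_measure d) =
    ennreal (gap_sum d M L)"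
proof -
  have L_prod: "0 \<le> (\<Prod>k=2..d. L m k)" for m
    using nonneg by (intro prod_nonneg) auto
  have "(\<integral>\<^sup>+y. ennreal (grd_weight d a y) * (\<Prod>k=2..d. g k (log_gap k y)) \<partial>simplex_measure d) =
      (\<Sum>m\<in>multi_indices d M. ennreal (multinomial d M m) * (\<Prod>k=2..d. ennreal (L m k)))"
    unfolding nn_integral_grd_weight_log_gaps[OF d a g]
    by (intro sum.cong arg_cong2[where f = "(*)"] prod.cong refl L)
  also have "\<dots> = (\<Sum>m\<in>multi_indices d M. ennreal (multinomial d M m * (\<Prod>k=2..d. L m k)))"
    using nonneg L_prod less_imp_le[OF multinomial_pos]
    by (intro sum.cong refl, subst prod_ennreal) (auto simp: ennreal_mult)
  also have "\<dots> = ennreal (gap_sum d M L)"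
    unfolding gap_sum_def
    by (intro sum_ennreal mult_nonneg_nonneg L_prod less_imp_le[OF multinomial_pos])
  finally show ?thesis .
qed

text \<open>Test functions equal to \<open>1\<close> leave the reciprocals of the rates, which are
  positive because tail sums of \<open>m\<close> only add to those of \<open>a\<close>.\<close>

lemma grd_const_eq:
  assumes d: "1 \<le> d" and pos: "\<forall>k\<in>{2..d}. 0 < tail_sum d a k" and a: "tail_sum d a 1 = - real M"
  shows "grd_const d a = ennreal (grd_normalizer d M a)" "0 < grd_normalizer d M a"
proof -
  have p: "0 < tail_sum d a k + real (tail_sum d m k)" if "k \<in> {2..d}" for m k
    using pos that by (simp add: add_pos_nonneg)
  have "(\<integral>\<^sup>+y. ennreal (grd_weight d a y) * (\<Prod>k=2..d. (\<lambda>_ _. 1) k (log_gap k y)) \<partial>simplex_measure d) =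
      ennreal (grd_normalizer d M a)"
    unfolding grd_normalizer_def
  proof (rule nn_integral_grd_weight_gap_sum[OF d a])
    fix m k assume "k \<in> {2..d}"
    then show "(\<integral>\<^sup>+z. 1 * ennreal (exp (- (tail_sum d a k + real (tail_sum d m k)) * z)) * indicator {0..} z \<partial>lborel)
        = ennreal (1 / (tail_sum d a k + real (tail_sum d m k)))"
      using nn_integral_power_exp[OF p[of k m], of 0] by simp
  qed (use p in \<open>auto intro: less_imp_le\<close>)
  then show "grd_const d a = ennreal (grd_normalizer d M a)"
    by (simp add: grd_const_def)
  show "0 < grd_normalizer d M a"
    unfolding grd_normalizer_def using p by (intro gap_sum_pos d) auto
qed

section \<open>Expectations under the GRD law\<close>

lemma nn_integral_GRD:
  assumes "f \<in> borel_measurable (\<Pi>\<^sub>M i\<in>{1..d}. borel)"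
  shows "(\<integral>\<^sup>+y. f y \<partial>GRD d a) = (\<integral>\<^sup>+y. ennreal (grd_weight d a y) * f y \<partial>simplex_measure d) / grd_const d a"
proof -
  have [measurable]: "f \<in> borel_measurable (simplex_measure d)"
      "grd_weight d a \<in> borel_measurable (simplex_measure d)"
    using assms by (auto intro: measurable_simplex_measure measurable_grd_weight)
  have "(\<integral>\<^sup>+y. f y \<partial>GRD d a) = (\<integral>\<^sup>+y. ennreal (grd_weight d a y) * f y / grd_const d a \<partial>simplex_measure d)"
    unfolding GRD_def by (subst nn_integral_density) (auto simp: divide_ennreal_def mult_ac)
  then show ?thesis by (simp add: nn_integral_divide)
qed

text \<open>The density vanishes with the weight, so only points of nonzero weight matter; there all
  components are positive.\<close>

lemma AE_GRD:
  assumes "1 \<le> d" and "\<And>y. y \<in> ordered_simplex d \<Longrightarrow> grd_weight d a y \<noteq> 0 \<Longrightarrow> P y"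
  shows "AE y in GRD d a. P y"
proof -
  have [measurable]: "grd_weight d a \<in> borel_measurable (simplex_measure d)"
    by (auto intro: measurable_simplex_measure measurable_grd_weight)
  have "P y" if "y \<in> space (simplex_measure d)" "0 < ennreal (grd_weight d a y) / grd_const d a" for y
    using assms(2)[of y] that space_simplex_measure[OF assms(1)]
    by (cases "grd_weight d a y = 0") auto
  then show ?thesis
    unfolding GRD_def by (subst AE_density) (auto intro!: AE_I2)
qed

lemma measurable_GRD:
  "f \<in> borel_measurable (\<Pi>\<^sub>M i\<in>{1..d}. borel) \<Longrightarrow> f \<in> borel_measurable (GRD d a)"
  by (simp only: GRD_def measurable_density_eq1 measurable_simplex_measure)

text \<open>Log gaps are nonnegative wherever the weight is nonzero, so the sign of
  \<open>h k\<close> matters only on the half-line, which admits odd powers. A finite nonnegative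
  integral then yields integrability and the value at once.\<close>

lemma integral_GRD_log_gaps:
  fixes h :: "nat \<Rightarrow> real \<Rightarrow> real"
  assumes d: "1 \<le> d" and pos: "\<forall>k\<in>{2..d}. 0 < tail_sum d a k" and a: "tail_sum d a 1 = - real M"
    and h: "\<And>k. h k \<in> borel_measurable borel"
    and h_nonneg: "\<And>k z. 0 \<le> z \<Longrightarrow> 0 \<le> h k z"
    and nonneg: "\<And>m k. k \<in> {2..d} \<Longrightarrow> 0 \<le> L m k"
    and L: "\<And>m k. k \<in> {2..d} \<Longrightarrow>
      (\<integral>\<^sup>+z. ennreal (h k z) * ennreal (exp (- (tail_sum d a k + real (tail_sum d m k)) * z)) * indicator {0..} z \<partial>lborel)
        = ennreal (L m k)"
  shows "integrable (GRD d a) (\<lambda>y. \<Prod>k=2..d. h k (log_gap k y)) \<and>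
    (\<integral>y. (\<Prod>k=2..d. h k (log_gap k y)) \<partial>GRD d a) = gap_sum d M L / grd_normalizer d M a"
proof -
  let ?f = "\<lambda>y. \<Prod>k=2..d. h k (log_gap k y)"
  have f: "?f \<in> borel_measurable (\<Pi>\<^sub>M i\<in>{1..d}. borel)"
    by (intro borel_measurable_prod measurable_compose[OF _ h] measurable_log_gap)
  have "(\<integral>\<^sup>+y. ennreal (?f y) \<partial>GRD d a) =
      (\<integral>\<^sup>+y. ennreal (grd_weight d a y) * ennreal (?f y) \<partial>simplex_measure d) / grd_const d a"
    by (intro nn_integral_GRD measurable_compose[OF f measurable_ennreal])
  also have "(\<integral>\<^sup>+y. ennreal (grd_weight d a y) * ennreal (?f y) \<partial>simplex_measure d) =
      (\<integral>\<^sup>+y. ennreal (grd_weight d a y) * (\<Prod>k=2..d. (\<lambda>z. ennreal (h k z)) (log_gap k y)) \<partial>simplex_measure d)"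
  proof (intro nn_integral_cong)
    fix y assume "y \<in> space (simplex_measure d)"
    then have y: "y \<in> ordered_simplex d" using d by (simp add: space_simplex_measure)
    show "ennreal (grd_weight d a y) * ennreal (?f y) =
        ennreal (grd_weight d a y) * (\<Prod>k=2..d. ennreal (h k (log_gap k y)))"
    proof (cases "grd_weight d a y = 0")
      case False
      then show ?thesis
        by (subst prod_ennreal) (auto intro!: h_nonneg log_gap_nonneg[OF y])
    qed simp
  qed
  also have "\<dots> = ennreal (gap_sum d M L)"
    using h nonneg L by (intro nn_integral_grd_weight_gap_sum[OF d a]) auto
  also have "ennreal (gap_sum d M L) / grd_const d a = ennreal (gap_sum d M L / grd_normalizer d M a)"
    using grd_const_eq[OF d pos a] gap_sum_nonneg[of d L M] nonneg by (simp add: divide_ennreal)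
  finally have nn: "(\<integral>\<^sup>+y. ennreal (?f y) \<partial>GRD d a) = ennreal (gap_sum d M L / grd_normalizer d M a)" .
  have "AE y in GRD d a. 0 \<le> ?f y"
    by (intro AE_GRD d prod_nonneg h_nonneg log_gap_nonneg)
  moreover have "0 \<le> gap_sum d M L / grd_normalizer d M a"
    using grd_const_eq(2)[OF d pos a] gap_sum_nonneg[of d L M] nonneg by simp
  ultimately show ?thesis
    using nn measurable_GRD[OF f] by (subst nn_integral_eq_integrable[symmetric]) auto
qed

text \<open>Adding \<open>M\<close> to the first parameter multiplies the weight by
  \<open>y 1 ^ M\<close>; dividing by this power recovers the weight of \<open>a\<close>, and the
  expectation is a quotient of normalising constants. The shifted parameters sum to
  \<open>0\<close>, where the multinomial sum has a single term.\<close>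

lemma integral_GRD_inverse_power:
  assumes d: "1 \<le> d" and pos: "\<forall>k\<in>{2..d}. 0 < tail_sum d a k" and a: "tail_sum d a 1 = - real M"
  shows "integrable (GRD d (a(1 := a 1 + real M))) (\<lambda>y. 1 / y 1 ^ M) \<and>
    (\<integral>y. 1 / y 1 ^ M \<partial>GRD d (a(1 := a 1 + real M))) =
      (\<Prod>k=2..d. tail_sum d a k) * grd_normalizer d M a"
proof -
  define b where "b = a(1 := a 1 + real M)"
  have tail: "tail_sum d b k = tail_sum d a k" if "2 \<le> k" for k
    using that unfolding tail_sum_def b_def by (intro sum.cong) auto
  have "tail_sum d b 1 = b 1 + tail_sum d b 2" "tail_sum d a 1 = a 1 + tail_sum d a 2"
    using d by (simp_all add: tail_sum_def sum.atLeast_Suc_atMost numeral_2_eq_2)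
  then have b: "tail_sum d b 1 = - real 0"
    using a tail[of 2] by (simp add: b_def)
  have pos_b: "\<forall>k\<in>{2..d}. 0 < tail_sum d b k"
    using pos tail by simp
  have P: "0 < (\<Prod>k=2..d. tail_sum d a k)"
    using pos by (intro prod_pos) auto
  have mi: "multi_indices d 0 = {\<lambda>i\<in>{1..d}. 0}"
    by (auto simp: multi_indices_eq fun_eq_iff PiE_def extensional_def)
  have "grd_normalizer d 0 b = (\<Prod>k=2..d. 1 / tail_sum d b k)"
    by (simp add: grd_normalizer_def gap_sum_def mi multinomial_def tail_sum_def)
  also have "\<dots> = 1 / (\<Prod>k=2..d. tail_sum d a k)"
    using tail by (simp add: prod_dividef)
  finally have norm_b: "grd_normalizer d 0 b = 1 / (\<Prod>k=2..d. tail_sum d a k)" .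
  let ?f = "\<lambda>y::nat \<Rightarrow> real. 1 / y 1 ^ M"
  have f: "?f \<in> borel_measurable (\<Pi>\<^sub>M i\<in>{1..d}. borel)"
    using d by (intro borel_measurable_divide borel_measurable_power borel_measurable_component borel_measurable_const) auto
  have weight: "grd_weight d b y * ?f y = grd_weight d a y" if y: "y \<in> ordered_simplex d" for y
  proof (cases "y 1 = 0")
    \<comment> \<open>Both weights are \<open>0\<close> here, so the value \<open>1 / 0 = 0\<close>
      does no harm.\<close>
    case True
    then have "grd_weight d b y = 0" "grd_weight d a y = 0"
      using d unfolding grd_weight_def by (auto intro!: bexI[of _ "1::nat"])
    then show ?thesis by simp
  next
    case False
    then have y1: "0 < y 1" using ordered_simplex_nonneg[OF y, of 1] d by simp
    have split: "grd_weight d c y = y 1 powr (c 1 - 1) * (\<Prod>k=2..d. y k powr (c k - 1))" for c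
      using d by (simp add: grd_weight_def prod.atLeast_Suc_atMost numeral_2_eq_2)
    have tail_prod: "(\<Prod>k=2..d. y k powr (b k - 1)) = (\<Prod>k=2..d. y k powr (a k - 1))"
      by (intro prod.cong) (auto simp: b_def)
    have first: "y 1 powr (b 1 - 1) * ?f y = y 1 powr (a 1 - 1)"
      using y1 by (simp add: b_def powr_realpow[symmetric] powr_diff powr_add)
    show ?thesis
      unfolding split tail_prod first[symmetric] by (simp only: mult_ac)
  qed
  have f0: "0 \<le> ?f y" if "y \<in> ordered_simplex d" for y
    using ordered_simplex_nonneg[OF that, of 1] d by simp
  have "(\<integral>\<^sup>+y. ennreal (?f y) \<partial>GRD d b) =
      (\<integral>\<^sup>+y. ennreal (grd_weight d b y) * ennreal (?f y) \<partial>simplex_measure d) / grd_const d b"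
    by (intro nn_integral_GRD measurable_compose[OF f measurable_ennreal])
  also have "(\<integral>\<^sup>+y. ennreal (grd_weight d b y) * ennreal (?f y) \<partial>simplex_measure d) = grd_const d a"
    unfolding grd_const_def
  proof (intro nn_integral_cong)
    fix y assume "y \<in> space (simplex_measure d)"
    then have y: "y \<in> ordered_simplex d" using d by (simp add: space_simplex_measure)
    show "ennreal (grd_weight d b y) * ennreal (?f y) = ennreal (grd_weight d a y)"
      using f0[OF y] weight[OF y] by (simp add: ennreal_mult[symmetric] grd_weight_nonneg)
  qed
  also have "grd_const d a / grd_const d b = ennreal ((\<Prod>k=2..d. tail_sum d a k) * grd_normalizer d M a)"
    using grd_const_eq[OF d pos a] grd_const_eq[OF d pos_b b] P
    by (simp add: divide_ennreal norm_b less_imp_le mult.commute)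
  finally have nn: "(\<integral>\<^sup>+y. ennreal (?f y) \<partial>GRD d b) =
      ennreal ((\<Prod>k=2..d. tail_sum d a k) * grd_normalizer d M a)" .
  have "AE y in GRD d b. 0 \<le> ?f y"
    using f0 by (intro AE_GRD d)
  then show ?thesis
    unfolding b_def[symmetric]
    using nn measurable_GRD[OF f] P grd_const_eq(2)[OF d pos a]
    by (subst nn_integral_eq_integrable[symmetric]) (auto simp: less_imp_le)
qed

section \<open>Moment generating function and moments of the log gaps\<close>

theorem corollary11:
  fixes d M :: nat and a :: "nat \<Rightarrow> real" and C :: real
  assumes "2 \<le> d"
    and "\<forall>k\<in>{2..d}. 0 < tail_sum d a k"
    and "1 \<le> M"
    and "tail_sum d a 1 = - real M"
    and "C = (\<integral>y. 1 / y 1 ^ M \<partial>GRD d (a(1 := a 1 + real M)))"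
  shows
    "integrable (GRD d (a(1 := a 1 + real M))) (\<lambda>y. 1 / y 1 ^ M) \<and>
     C = (\<Sum>m\<in>multi_indices d M. multinomial d M m *
            (\<Prod>k=2..d. tail_sum d a k / (tail_sum d a k + real (tail_sum d m k)))) \<and>
     (\<forall>t :: nat \<Rightarrow> real. (\<forall>k\<in>{2..d}. t k < tail_sum d a k) \<longrightarrow>
        integrable (GRD d a) (\<lambda>y. exp (\<Sum>k=2..d. t k * log_gap k y)) \<and>
        (\<integral>y. exp (\<Sum>k=2..d. t k * log_gap k y) \<partial>GRD d a) =
          inverse C * (\<Sum>m\<in>multi_indices d M. multinomial d M m *
            (\<Prod>k=2..d. tail_sum d a k / (tail_sum d a k - t k + real (tail_sum d m k))))) \<and>
     (\<forall>n :: nat \<Rightarrow> nat.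
        integrable (GRD d a) (\<lambda>y. \<Prod>k=2..d. log_gap k y ^ n k) \<and>
        (\<integral>y. (\<Prod>k=2..d. log_gap k y ^ n k) \<partial>GRD d a) =
          inverse C * (\<Sum>m\<in>multi_indices d M. multinomial d M m *
            (\<Prod>k=2..d. tail_sum d a k * fact (n k) /
                       (tail_sum d a k + real (tail_sum d m k)) ^ (n k + 1))))"
proof -
  note a = assms(4) and pos = assms(2)
  have d: "1 \<le> d" using assms(1) by simp
  let ?P = "\<Prod>k=2..d. tail_sum d a k" and ?Q = "grd_normalizer d M a"
  have P: "0 < ?P" using pos by (intro prod_pos) auto
  have C: "C = ?P * ?Q"
    using integral_GRD_inverse_power[OF d pos a] assms(5) by simp
  have sum_eq: "(\<Sum>m\<in>multi_indices d M. multinomial d M m * (\<Prod>k=2..d. tail_sum d a k * L m k)) =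
      ?P * gap_sum d M L" for L
    unfolding gap_sum_mult[symmetric] by (simp add: gap_sum_def)
  \<comment> \<open>The factor \<open>?P\<close> occurs in \<open>C\<close> and can be pulled out of
    the sum; cancelling it leaves the quotient given by
    \<open>integral_GRD_log_gaps\<close>.\<close>
  have quotient: "inverse C * (\<Sum>m\<in>multi_indices d M. multinomial d M m * (\<Prod>k=2..d. tail_sum d a k * L m k)) =
      gap_sum d M L / ?Q" for L
  proof -
    have cancel: "inverse (p * q) * (p * s) = s / q" if "0 < p" for p q s :: real
      using that by (simp add: field_simps)
    show ?thesis unfolding sum_eq C by (rule cancel[OF P])
  qed
  have p: "0 < tail_sum d a k + real (tail_sum d m k)" if "k \<in> {2..d}" for m k
    using pos that by (simp add: add_pos_nonneg)
  show ?thesis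
  proof (intro conjI allI impI)
    show "integrable (GRD d (a(1 := a 1 + real M))) (\<lambda>y. 1 / y 1 ^ M)"
      using integral_GRD_inverse_power[OF d pos a] by simp
    show "C = (\<Sum>m\<in>multi_indices d M. multinomial d M m *
            (\<Prod>k=2..d. tail_sum d a k / (tail_sum d a k + real (tail_sum d m k))))"
      using sum_eq[of "\<lambda>m k. 1 / (tail_sum d a k + real (tail_sum d m k))"]
      by (simp add: C grd_normalizer_def)
  next
    fix t :: "nat \<Rightarrow> real"
    assume t: "\<forall>k\<in>{2..d}. t k < tail_sum d a k"
    let ?L = "\<lambda>m k. 1 / (tail_sum d a k - t k + real (tail_sum d m k))"
    have q: "0 < tail_sum d a k - t k + real (tail_sum d m k)" if "k \<in> {2..d}" for m k
      using t that by (intro add_pos_nonneg) auto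
    \<comment> \<open>Splitting the exponential over the gaps lowers the rate of gap
      \<open>k\<close> by \<open>t k\<close>; \<open>t k < tail_sum d a k\<close> keeps it
      positive.\<close>
    have "integrable (GRD d a) (\<lambda>y. \<Prod>k=2..d. exp (t k * log_gap k y)) \<and>
        (\<integral>y. (\<Prod>k=2..d. exp (t k * log_gap k y)) \<partial>GRD d a) = gap_sum d M ?L / ?Q"
    proof (rule integral_GRD_log_gaps[OF d pos a])
      fix m k assume k: "k \<in> {2..d}"
      have "ennreal (exp (t k * z)) * ennreal (exp (- (tail_sum d a k + real (tail_sum d m k)) * z)) =
          ennreal (exp (- (tail_sum d a k - t k + real (tail_sum d m k)) * z))" for z
        by (simp add: ennreal_mult[symmetric] exp_add[symmetric] algebra_simps)
      then show "(\<integral>\<^sup>+z. ennreal (exp (t k * z)) *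
          ennreal (exp (- (tail_sum d a k + real (tail_sum d m k)) * z)) * indicator {0..} z \<partial>lborel) = ennreal (?L m k)"
        using nn_integral_power_exp[OF q[OF k, of m], of 0] by simp
    qed (use q in \<open>auto intro: less_imp_le\<close>)
    then show "integrable (GRD d a) (\<lambda>y. exp (\<Sum>k=2..d. t k * log_gap k y))"
      and "(\<integral>y. exp (\<Sum>k=2..d. t k * log_gap k y) \<partial>GRD d a) =
          inverse C * (\<Sum>m\<in>multi_indices d M. multinomial d M m *
            (\<Prod>k=2..d. tail_sum d a k / (tail_sum d a k - t k + real (tail_sum d m k))))"
      using quotient[of ?L] by (simp_all add: exp_sum)
  next
    fix n :: "nat \<Rightarrow> nat"
    let ?L = "\<lambda>m k. fact (n k) / (tail_sum d a k + real (tail_sum d m k)) ^ (n k + 1)"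
    \<comment> \<open>With \<open>h k z = z ^ n k\<close> the one-dimensional integrals are moments
      against unnormalised exponentials, hence the exponent \<open>n k + 1\<close>.\<close>
    have "integrable (GRD d a) (\<lambda>y. \<Prod>k=2..d. log_gap k y ^ n k) \<and>
        (\<integral>y. (\<Prod>k=2..d. log_gap k y ^ n k) \<partial>GRD d a) = gap_sum d M ?L / ?Q"
      using p by (intro integral_GRD_log_gaps[OF d pos a] nn_integral_power_exp)
        (auto intro: less_imp_le)
    then show "integrable (GRD d a) (\<lambda>y. \<Prod>k=2..d. log_gap k y ^ n k)"
      and "(\<integral>y. (\<Prod>k=2..d. log_gap k y ^ n k) \<partial>GRD d a) =
          inverse C * (\<Sum>m\<in>multi_indices d M. multinomial d M m *
            (\<Prod>k=2..d. tail_sum d a k * fact (n k) /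
                       (tail_sum d a k + real (tail_sum d m k)) ^ (n k + 1)))"
      using quotient[of ?L] by simp_all
  qed
qed

end
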